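(* Let $X$ be a complex Banach space, $\omega>0$, $c\in\mathbb{C}\setminus\{0\}$, and let $A$ be the infinitesimal generator of a strongly continuous semigroup $\{S(t)\}_{t\ge0}$ of bounded linear operators on $X$ such that $S(t)$ is compact for every $t>0$. Let $Q\ge1$ and $\gamma\in\mathbb{R}$ be constants with $\|S(t)\|\le Qe^{\gamma t}$ for all $t\ge0$. Suppose $c\notin\sigma(S(\omega))$. Let $g\in C(\mathbb{R}_+\times X,X)$ satisfy (i) $g(t+\omega,cy)=cg(t,y)$ for all $t\in\mathbb{R}_+$ and $y\in X$; (ii) there is a constant $L>0$ such that $\|g(t,y_1)-g(t,y_2)\|\le L\|y_1-y_2\|$ for all $t\in\mathbb{R}_+$ and $y_1,y_2\in X$; (iii) there are constants $g_1\ge0$ and $g_2\ge0$ such that $\|g(t,y)\|\le g_1+g_2\|y\|$ for all $t\in\mathbb{R}_+$ and $y\in X$. If $$Q\,\|(cI-S(\omega))^{-1}\|\,e^{\gamma\omega}\left(e^{Qg_2\omega}-1\right)<1,$$ then the equation $\dot y=Ay+g(t,y)$ has an $(\omega,c)$-periodic mild solution $y\in C(\mathbb{R}_+,X)$.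
   Context: $\mathbb{R}_+=[0,\infty)$. A function $y:\mathbb{R}_+\to X$ is $(\omega,c)$-periodic if $y(t+\omega)=cy(t)$ for all $t\in\mathbb{R}_+$. A mild solution of $\dot y=Ay+g(t,y)$ is a function $y\in C(\mathbb{R}_+,X)$ such that for some $y_0\in X$ $$y(t)=S(t)y_0+\int_0^tS(t-s)g(s,y(s))\,ds\quad\text{for all }t\in\mathbb{R}_+.$$ $I$ is the identity on $X$ and $\sigma(\cdot)$ denotes the spectrum. *)

theory Defs
  imports "HOL-Analysis.Analysis"
begin

text \<open>
  A complex Banach space is a real Banach space whose real scalar multiplication and norm extend
  to a complex scalar multiplication. Completeness, topology and the integral are those of the
  underlying real space.
\<close>

class complex_banach = banach +
  fixes scaleC :: "complex \<Rightarrow> 'a \<Rightarrow> 'a" (infixr "*\<^sub>C" 75)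
  assumes scaleC_add_right: "a *\<^sub>C (x + y) = a *\<^sub>C x + a *\<^sub>C y"
    and scaleC_add_left: "(a + b) *\<^sub>C x = a *\<^sub>C x + b *\<^sub>C x"
    and scaleC_scaleC: "a *\<^sub>C b *\<^sub>C x = (a * b) *\<^sub>C x"
    and scaleC_of_real: "complex_of_real r *\<^sub>C x = r *\<^sub>R x"
    and norm_scaleC: "norm (a *\<^sub>C x) = cmod a * norm x"

instantiation complex :: complex_banach
begin

definition scaleC_complex :: "complex \<Rightarrow> complex \<Rightarrow> complex"
  where "scaleC_complex a x = a * x"

instance
  by standard (auto simp: scaleC_complex_def algebra_simps norm_mult scaleR_conv_of_real)

end

definition bounded_clinear :: "('a::complex_banach \<Rightarrow> 'a) \<Rightarrow> bool"
  where "bounded_clinear T \<longleftrightarrow> bounded_linear T \<and> (\<forall>a x. T (a *\<^sub>C x) = a *\<^sub>C T x)"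

definition compact_operator :: "('a::complex_banach \<Rightarrow> 'a) \<Rightarrow> bool"
  where "compact_operator T \<longleftrightarrow>
    bounded_clinear T \<and> (\<forall>B. bounded B \<longrightarrow> compact (closure (T ` B)))"

definition spectrum :: "('a::complex_banach \<Rightarrow> 'a) \<Rightarrow> complex set"
  where "spectrum T = {z. \<not> (bij (\<lambda>x. z *\<^sub>C x - T x) \<and>
                              bounded_clinear (inv (\<lambda>x. z *\<^sub>C x - T x)))}"

text \<open>Semigroups are total functions of a real parameter; only their values at \<open>t \<ge> 0\<close> matter.\<close>

definition C0_semigroup :: "(real \<Rightarrow> 'a::complex_banach \<Rightarrow> 'a) \<Rightarrow> bool"
  where "C0_semigroup S \<longleftrightarrow>
    (\<forall>t\<ge>0. bounded_clinear (S t)) \<and>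
    S 0 = id \<and>
    (\<forall>s\<ge>0. \<forall>t\<ge>0. S (s + t) = S s \<circ> S t) \<and>
    (\<forall>x. ((\<lambda>t. S t x) \<longlongrightarrow> x) (at_right 0))"

text \<open>
  The unbounded operator is given by its domain \<open>D\<close> and a function \<open>A\<close> whose values outside \<open>D\<close>
  are irrelevant.
\<close>

definition infinitesimal_generator ::
    "'a set \<Rightarrow> ('a \<Rightarrow> 'a) \<Rightarrow> (real \<Rightarrow> 'a::complex_banach \<Rightarrow> 'a) \<Rightarrow> bool"
  where "infinitesimal_generator D A S \<longleftrightarrow>
    D = {x. \<exists>l. ((\<lambda>h. (S h x - x) /\<^sub>R h) \<longlongrightarrow> l) (at_right 0)} \<and>
    (\<forall>x\<in>D. ((\<lambda>h. (S h x - x) /\<^sub>R h) \<longlongrightarrow> A x) (at_right 0))"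

text \<open>
  Mild solutions on \<open>[0,\<infinity>)\<close> of \<open>y' = A y + g(t,y)\<close>, where \<open>S\<close> is the semigroup generated by \<open>A\<close>.
  For continuous \<open>g\<close> the integrand is continuous, so the Henstock--Kurzweil integral used here
  is the Riemann integral.
\<close>

definition mild_solution ::
    "(real \<Rightarrow> 'a::complex_banach \<Rightarrow> 'a) \<Rightarrow> (real \<Rightarrow> 'a \<Rightarrow> 'a) \<Rightarrow> (real \<Rightarrow> 'a) \<Rightarrow> bool"
  where "mild_solution S g y \<longleftrightarrow>
    continuous_on {0..} y \<and>
    (\<exists>y0. \<forall>t\<ge>0. (\<lambda>s. S (t - s) (g s (y s))) integrable_on {0..t} \<and>
                 y t = S t y0 + integral {0..t} (\<lambda>s. S (t - s) (g s (y s))))"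

definition omega_c_periodic :: "real \<Rightarrow> complex \<Rightarrow> (real \<Rightarrow> 'a::complex_banach) \<Rightarrow> bool"
  where "omega_c_periodic \<omega> c y \<longleftrightarrow> (\<forall>t\<ge>0. y (t + \<omega>) = c *\<^sub>C y t)"

end

theory Submission
  imports Defs
begin

text \<open>
  By Picard iteration every initial value \<open>x\<close> has a unique global mild solution \<open>y\<close>, depending
  continuously on \<open>x\<close>. Uniqueness, applied to \<open>y\<close> and \<open>t \<mapsto> c\<inverse> y (t + \<omega>)\<close>, shows that \<open>y\<close> is
  \<open>(\<omega>, c)\<close>-periodic as soon as \<open>y \<omega> = c x\<close>, i.e. as soon as \<open>x\<close> is a fixed point of
  \<open>x \<mapsto> (c I - S \<omega>)\<inverse> (\<integral>\<^sub>0\<^sup>\<omega> S (\<omega> - s) g(s, y s) ds)\<close>. This map is compact because \<open>S t\<close> is compact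
  for \<open>t > 0\<close>, and by Gronwall's inequality and the smallness condition it maps a large ball into
  itself, so Schauder's theorem applies. Schauder's theorem is reduced to Brouwer's in the cube
  \<open>[0,1]\<^sup>n\<close>, which comes from Kuhn's combinatorial lemma; the dimension \<open>n\<close> is arbitrary, so the cube
  is modelled by functions on \<open>nat\<close> rather than by a Euclidean type.
\<close>

subsection \<open>Fixed point theorems of Brouwer and Schauder\<close>

text \<open>Coordinates from \<open>n\<close> on are pinned to 0, which makes the cube a product of
  compact sets over all of \<open>nat\<close>; convergence in it is coordinatewise.\<close>

definition unit_cube :: "nat \<Rightarrow> (nat \<Rightarrow> real) set"
  where "unit_cube n = {x. (\<forall>i<n. 0 \<le> x i \<and> x i \<le> 1) \<and> (\<forall>i\<ge>n. x i = 0)}"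

lemma compact_unit_cube: "compact (unit_cube n)"
proof -
  have "unit_cube n = PiE UNIV (\<lambda>i. if i < n then {0..1} else {0})"
    by (force simp: unit_cube_def PiE_iff split: if_splits)
  then have "compactin (product_topology (\<lambda>i. euclidean) UNIV) (unit_cube n)"
    by (simp add: compactin_PiE)
  then show ?thesis
    by (simp add: euclidean_product_topology)
qed

lemma tendsto_fun_coordinatewise_iff:
  fixes f :: "'b \<Rightarrow> 'i \<Rightarrow> 'c::topological_space"
  shows "(f \<longlongrightarrow> l) F \<longleftrightarrow> (\<forall>i. ((\<lambda>b. f b i) \<longlongrightarrow> l i) F)"
  using limitin_componentwise[of "\<lambda>_. euclidean" UNIV f l F]
  by (simp add: euclidean_product_topology)

text \<open>Kuhn's lemma finds, in a grid of mesh \<open>1 / p\<close>, a cell where for each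
  coordinate one vertex is not moved down by \<open>f\<close> and another is not moved up. As the
  mesh tends to 0 the cells accumulate at a point where both inequalities hold, for every
  coordinate.\<close>

lemma brouwer_unit_cube:
  assumes cont: "continuous_on (unit_cube n) f" and into: "f \<in> unit_cube n \<rightarrow> unit_cube n"
  obtains x where "x \<in> unit_cube n" "f x = x"
proof -
  define pt where "pt p x = (\<lambda>i. if i < n then real (x i) / real p else 0)" for p :: nat and x
  have pt_cube: "pt p x \<in> unit_cube n" if "\<forall>i<n. x i \<le> p" "p > 0" for p x
    using that by (auto simp: unit_cube_def pt_def)
  have approx: "\<exists>Q\<in>unit_cube n. \<forall>i<n. \<exists>A\<in>unit_cube n. \<exists>B\<in>unit_cube n.
      (\<forall>j. \<bar>A j - Q j\<bar> \<le> 1 / p \<and> \<bar>B j - Q j\<bar> \<le> 1 / p) \<and> A i \<le> f A i \<and> f B i \<le> B i"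
    if p: "p > 0" for p :: nat
  proof -
    \<comment> \<open>Label 0 records that coordinate \<open>i\<close> is not decreased by
      \<open>f\<close>, label 1 that it is not increased. On the faces the label is forced to the
      value Kuhn's lemma demands; this agrees with the meaning because \<open>f\<close> stays in the
      cube.\<close>
    define label where
      "label x i = (if x i = 0 \<or> (x i \<noteq> p \<and> f (pt p x) i > pt p x i) then 0 else 1::nat)" for x i
    obtain q where q: "\<forall>i<n. q i < p"
      and rs: "\<forall>i<n. \<exists>r s. (\<forall>j<n. q j \<le> r j \<and> r j \<le> q j + 1) \<and>
        (\<forall>j<n. q j \<le> s j \<and> s j \<le> q j + 1) \<and> label r i \<noteq> label s i"
      by (rule kuhn_lemma[of p n label]) (use p in \<open>auto simp: label_def\<close>)
    have near: "pt p r \<in> unit_cube n \<and> (\<forall>j. \<bar>pt p r j - pt p q j\<bar> \<le> 1 / p) \<and>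
        (label r i = 0 \<longrightarrow> pt p r i \<le> f (pt p r) i) \<and> (label r i \<noteq> 0 \<longrightarrow> f (pt p r) i \<le> pt p r i)"
      if r: "\<forall>j<n. q j \<le> r j \<and> r j \<le> q j + 1" and i: "i < n" for r i
    proof (intro conjI)
      show rc: "pt p r \<in> unit_cube n"
        using r q p by (intro pt_cube) (auto, metis Suc_leI le_trans)
      then have f: "f (pt p r) \<in> unit_cube n"
        using into by auto
      show "\<forall>j. \<bar>pt p r j - pt p q j\<bar> \<le> 1 / p"
      proof
        fix j
        show "\<bar>pt p r j - pt p q j\<bar> \<le> 1 / p"
        proof (cases "j < n")
          case True
          then have "q j \<le> r j \<and> r j \<le> q j + 1" using r by auto
          then have "\<bar>real (r j) - real (q j)\<bar> \<le> 1" by auto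
          then have "\<bar>real (r j) - real (q j)\<bar> / p \<le> 1 / p"
            by (intro divide_right_mono) auto
          then show ?thesis
            using True p by (simp add: pt_def diff_divide_distrib[symmetric] abs_div)
        qed (simp add: pt_def)
      qed
      show "label r i = 0 \<longrightarrow> pt p r i \<le> f (pt p r) i"
        using f i by (auto simp: label_def unit_cube_def pt_def split: if_splits)
      show "label r i \<noteq> 0 \<longrightarrow> f (pt p r) i \<le> pt p r i"
        using f i p by (auto simp: label_def unit_cube_def pt_def split: if_splits)
    qed
    have "\<exists>A\<in>unit_cube n. \<exists>B\<in>unit_cube n.
      (\<forall>j. \<bar>A j - pt p q j\<bar> \<le> 1 / p \<and> \<bar>B j - pt p q j\<bar> \<le> 1 / p) \<and> A i \<le> f A i \<and> f B i \<le> B i"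
      if i: "i < n" for i
    proof -
      obtain r s where r: "\<forall>j<n. q j \<le> r j \<and> r j \<le> q j + 1"
        and s: "\<forall>j<n. q j \<le> s j \<and> s j \<le> q j + 1" and l: "label r i \<noteq> label s i"
        using rs i by blast
      note nr = near[OF r i] and ns = near[OF s i]
      show ?thesis
      proof (cases "label r i = 0")
        case True
        then show ?thesis using nr ns l by (intro bexI[of _ "pt p r"] bexI[of _ "pt p s"]) auto
      next
        case False
        then have "label s i = 0" using l by (auto simp: label_def split: if_splits)
        then show ?thesis using nr ns False
          by (intro bexI[of _ "pt p s"] bexI[of _ "pt p r"]) auto
      qed
    qed
    moreover have "pt p q \<in> unit_cube n"
      using q p by (intro pt_cube) (auto intro: less_imp_le)
    ultimately show ?thesis by blast
  qed
  \<comment> \<open>The witnesses \<open>A\<close> and \<open>B\<close> may change with the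
    coordinate, but all lie near the common point \<open>Q\<close>, so a single limit serves every
    coordinate. The mesh parameter \<open>Suc k\<close> is never 0.\<close>
  define good where "good k Q \<longleftrightarrow> Q \<in> unit_cube n \<and> (\<forall>i<n. \<exists>A\<in>unit_cube n. \<exists>B\<in>unit_cube n.
      (\<forall>j. \<bar>A j - Q j\<bar> \<le> 1 / Suc k \<and> \<bar>B j - Q j\<bar> \<le> 1 / Suc k) \<and> A i \<le> f A i \<and> f B i \<le> B i)" for k Q
  have "\<exists>Q. good k Q" for k
    using approx[of "Suc k"] unfolding good_def by blast
  then obtain Q where Q: "\<And>k. good k (Q k)" by metis
  then have "\<forall>k. Q k \<in> unit_cube n" by (auto simp: good_def)
  then obtain l r where l: "l \<in> unit_cube n" and r: "strict_mono r" and Ql: "(Q \<circ> r) \<longlonglongrightarrow> l"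
    using compact_unit_cube[of n] unfolding compact_eq_seq_compact_metric seq_compact_def by metis
  have lim: "f l i = l i" if i: "i < n" for i
  proof -
    have "\<forall>k. \<exists>A B. A \<in> unit_cube n \<and> B \<in> unit_cube n \<and>
      (\<forall>j. \<bar>A j - Q k j\<bar> \<le> 1 / Suc k \<and> \<bar>B j - Q k j\<bar> \<le> 1 / Suc k) \<and> A i \<le> f A i \<and> f B i \<le> B i"
      using Q i unfolding good_def by blast
    then obtain A B where AB: "\<And>k. A k \<in> unit_cube n" "\<And>k. B k \<in> unit_cube n"
      "\<And>k j. \<bar>A k j - Q k j\<bar> \<le> 1 / Suc k" "\<And>k j. \<bar>B k j - Q k j\<bar> \<le> 1 / Suc k"
      "\<And>k. A k i \<le> f (A k) i" "\<And>k. f (B k) i \<le> B k i"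
      by metis
    \<comment> \<open>Either family of witnesses is dragged along to the limit \<open>l\<close> of
      the cells, so continuity of \<open>f\<close> carries both inequalities over to
      \<open>l\<close>.\<close>
    have conv: "(\<lambda>k. A (r k)) \<longlonglongrightarrow> l \<and> (\<lambda>k. f (A (r k))) \<longlonglongrightarrow> f l"
      if A: "\<And>k. A k \<in> unit_cube n" "\<And>k j. \<bar>A k j - Q k j\<bar> \<le> 1 / Suc k" for A
    proof -
      have 0: "(\<lambda>k. A (r k) j - Q (r k) j) \<longlonglongrightarrow> 0" for j
      proof (rule Lim_null_comparison)
        show "(\<lambda>k. 1 / real (Suc (r k))) \<longlonglongrightarrow> 0"
          using LIMSEQ_subseq_LIMSEQ[OF LIMSEQ_Suc[OF lim_const_over_n[of 1]] r] by (simp add: o_def)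
      qed (use A in auto)
      have lj: "(\<lambda>k. Q (r k) j) \<longlonglongrightarrow> l j" for j
        using Ql by (simp add: tendsto_fun_coordinatewise_iff o_def)
      have "(\<lambda>k. A (r k) j) \<longlonglongrightarrow> l j" for j
        using tendsto_add[OF 0[of j] lj[of j]] by simp
      then have *: "(\<lambda>k. A (r k)) \<longlonglongrightarrow> l"
        by (simp add: tendsto_fun_coordinatewise_iff)
      with A l cont show ?thesis
        by (auto intro: continuous_on_tendsto_compose[of _ f])
    qed
    have "l i \<le> f l i"
      using conv[OF AB(1,3)] AB(5)
      by (intro LIMSEQ_le[of "\<lambda>k. A (r k) i" "l i" "\<lambda>k. f (A (r k)) i"])
         (auto simp: tendsto_fun_coordinatewise_iff)
    moreover have "f l i \<le> l i"
      using conv[OF AB(2,4)] AB(6)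
      by (intro LIMSEQ_le[of "\<lambda>k. f (B (r k)) i" _ "\<lambda>k. B (r k) i"])
         (auto simp: tendsto_fun_coordinatewise_iff)
    ultimately show ?thesis by simp
  qed
  have "f l \<in> unit_cube n" using into l by auto
  then have "f l i = l i" for i
    using lim l by (cases "i < n") (auto simp: unit_cube_def)
  then show thesis using l that by blast
qed

section \<open>Schauder's theorem by finite-dimensional approximation\<close>

text \<open>A finite \<open>e\<close>-net of \<open>C\<close> with a subordinate partition of unity
  replaces each point of \<open>C\<close> by a convex combination of net points at distance at most
  \<open>e\<close>. Brouwer's theorem is applied to the coefficients of such combinations.\<close>

lemma schauder_approximate:
  fixes f :: "'a::real_normed_vector \<Rightarrow> 'a"
  assumes K: "convex K" "K \<noteq> {}" and C: "compact C" "C \<subseteq> K"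
    and cont: "continuous_on K f" and into: "f \<in> K \<rightarrow> C" and e: "e > 0"
  obtains x where "x \<in> K" "norm (f x - x) \<le> e"
proof -
  have "C \<noteq> {}" using K into by auto
  obtain D where D: "finite D" "D \<subseteq> C" "C \<subseteq> (\<Union>d\<in>D. ball d e)"
  proof (rule compactE_image[OF C(1), of C "\<lambda>x. ball x e"])
    show "C \<subseteq> (\<Union>x\<in>C. ball x e)" using e by force
  qed auto
  obtain c and n :: nat where c: "D = c ` {i. i < n}"
    using D(1) unfolding finite_conv_nat_seg_image by blast
  have n: "n > 0" using D(3) \<open>C \<noteq> {}\<close> c by auto
  have cK: "c i \<in> K" if "i < n" for i using that c D C by auto
  \<comment> \<open>Tent functions that vanish at distance \<open>e\<close> or more from the net
    point; \<open>w\<close> normalises them to a partition of unity on \<open>C\<close>.\<close>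
  define u where "u y i = max 0 (e - dist y (c i))" for y i
  define w where "w y i = u y i / (\<Sum>j<n. u y j)" for y i
  have upos: "(\<Sum>j<n. u y j) > 0" if y: "y \<in> C" for y
  proof -
    obtain i where i: "i < n" "dist y (c i) < e"
      using y D(3) c by (auto simp: dist_commute)
    then show ?thesis
      by (intro sum_pos2[of _ i]) (auto simp: u_def)
  qed
  have w: "(\<Sum>i<n. w y i) = 1" "0 \<le> w y i" "i < n \<Longrightarrow> w y i \<le> 1" if "y \<in> C" for y i
  proof -
    show "(\<Sum>i<n. w y i) = 1"
      using upos[OF that] by (simp add: w_def sum_divide_distrib[symmetric])
    show "0 \<le> w y i"
      using upos[OF that] by (auto simp: w_def u_def intro!: divide_nonneg_pos)
    assume "i < n"
    then have "u y i \<le> (\<Sum>j<n. u y j)"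
      by (intro member_le_sum) (auto simp: u_def)
    then show "w y i \<le> 1"
      using upos[OF that] by (simp add: w_def)
  qed
  \<comment> \<open>A continuous map of the cube onto the simplex that fixes the simplex: a
    coordinate sum below 1 is topped up equally in all coordinates, a sum above 1 is divided away.
    It allows Brouwer's theorem to be used on the cube.\<close>
  define r where "r a i = (a i + max 0 (1 - (\<Sum>j<n. a j)) / n) / max 1 (\<Sum>j<n. a j)" for a :: "nat \<Rightarrow> real" and i
  define h where "h a = (\<Sum>i<n. r a i *\<^sub>R c i)" for a
  have hK: "h a \<in> K" if "a \<in> unit_cube n" for a
    unfolding h_def
  proof (rule convex_sum)
    show "(\<Sum>i<n. r a i) = 1"
    proof (cases "(\<Sum>j<n. a j) \<le> 1")
      case True
      then show ?thesis using n by (simp add: r_def sum.distrib)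
    next
      case False
      then show ?thesis by (simp add: r_def max_def sum_divide_distrib[symmetric])
    qed
    show "0 \<le> r a i" if "i \<in> {..<n}" for i
      using \<open>a \<in> unit_cube n\<close> that by (auto simp: r_def unit_cube_def)
  qed (use K cK in auto)
  define F where "F a = (\<lambda>i. if i < n then w (f (h a)) i else 0)" for a
  have coord: "continuous_on A (\<lambda>a. a i)" for A :: "(nat \<Rightarrow> real) set" and i
    by (rule continuous_on_subset[OF continuous_on_product_coordinates]) simp
  have conth: "continuous_on (unit_cube n) h"
    unfolding h_def r_def by (intro continuous_intros coord) auto
  have contfh: "continuous_on (unit_cube n) (\<lambda>a. f (h a))"
    by (rule continuous_on_compose2[OF cont conth]) (use hK in auto)
  have fhC: "f (h a) \<in> C" if "a \<in> unit_cube n" for a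
    using hK[OF that] into by auto
  have "continuous_on (unit_cube n) F"
    unfolding F_def
  proof (rule continuous_on_coordinatewise_then_product)
    fix i
    show "continuous_on (unit_cube n) (\<lambda>a. if i < n then w (f (h a)) i else 0)"
      unfolding w_def u_def
      using upos[OF fhC, unfolded u_def] contfh
      by (cases "i < n") (fastforce intro!: continuous_intros)+
  qed
  moreover have "F \<in> unit_cube n \<rightarrow> unit_cube n"
    using w fhC by (auto simp: F_def unit_cube_def)
  ultimately obtain a where a: "a \<in> unit_cube n" "F a = a"
    by (rule brouwer_unit_cube)
  have ai: "a i = w (f (h a)) i" if "i < n" for i
    using fun_cong[OF a(2), of i] that by (simp add: F_def)
  define y where "y = f (h a)"
  have y: "y \<in> C" using fhC a by (simp add: y_def)
  \<comment> \<open>The fixed coefficients are weights of \<open>y\<close>, so they lie in the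
    simplex already and \<open>r\<close> does not alter them. Hence \<open>h a\<close> is the
    approximation of \<open>y = f (h a)\<close> by net points, and only net points closer than
    \<open>e\<close> to \<open>y\<close> contribute.\<close>
  have "(\<Sum>i<n. a i) = 1"
    using w(1)[OF y] ai by (simp add: y_def)
  then have "r a i = a i" for i by (simp add: r_def)
  then have ha: "h a = (\<Sum>i<n. w y i *\<^sub>R c i)"
    using ai by (simp add: h_def y_def)
  have "y - h a = (\<Sum>i<n. w y i *\<^sub>R (y - c i))"
    using w(1)[OF y] by (simp add: ha scaleR_diff_right sum_subtractf flip: scaleR_sum_left)
  also have "norm \<dots> \<le> (\<Sum>i<n. w y i * e)"
  proof (rule sum_norm_le)
    fix i assume "i \<in> {..<n}"
    show "norm (w y i *\<^sub>R (y - c i)) \<le> w y i * e"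
    proof (cases "dist y (c i) < e")
      case True
      then show ?thesis using w(2)[OF y, of i] by (simp add: dist_norm mult_left_mono)
    next
      case False
      then show ?thesis by (simp add: w_def u_def)
    qed
  qed
  also have "\<dots> = e"
    using w(1)[OF y] by (simp flip: sum_distrib_right)
  finally show thesis
    using that hK a(1) unfolding y_def by blast
qed

text \<open>Approximate fixed points have images in the compact set \<open>C\<close>, so a
  subsequence of the images converges; the points themselves then have the same limit, which lies in
  \<open>C\<close> and so in \<open>K\<close>, where \<open>f\<close> is continuous.\<close>

theorem schauder:
  fixes f :: "'a::real_normed_vector \<Rightarrow> 'a"
  assumes K: "convex K" "K \<noteq> {}" and C: "compact C" "C \<subseteq> K"
    and cont: "continuous_on K f" and into: "f \<in> K \<rightarrow> C"
  obtains x where "x \<in> K" "f x = x"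
proof -
  have "\<exists>x\<in>K. norm (f x - x) \<le> 1 / Suc k" for k
    using schauder_approximate[OF assms, of "1 / Suc k"] by (metis of_nat_0_less_iff zero_less_Suc zero_less_divide_1_iff)
  then obtain x where x: "\<And>k. x k \<in> K" "\<And>k. norm (f (x k) - x k) \<le> 1 / Suc k" by metis
  then have "\<forall>k. f (x k) \<in> C" using into by auto
  then obtain l r where l: "l \<in> C" and r: "strict_mono r" and fl: "((\<lambda>k. f (x k)) \<circ> r) \<longlonglongrightarrow> l"
    using C(1) unfolding compact_eq_seq_compact_metric seq_compact_def by metis
  have "(\<lambda>k. f (x (r k)) - x (r k)) \<longlonglongrightarrow> 0"
  proof (rule Lim_null_comparison)
    show "(\<lambda>k. 1 / real (Suc (r k))) \<longlonglongrightarrow> 0"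
      using LIMSEQ_subseq_LIMSEQ[OF LIMSEQ_Suc[OF lim_const_over_n[of 1]] r] by (simp add: o_def)
  qed (use x in auto)
  from tendsto_diff[OF fl[unfolded o_def] this] have "(\<lambda>k. x (r k)) \<longlonglongrightarrow> l" by simp
  then have "(\<lambda>k. f (x (r k))) \<longlonglongrightarrow> f l"
    using l C x cont by (auto intro: continuous_on_tendsto_compose[of K f])
  with fl have "f l = l" by (auto simp: o_def intro: LIMSEQ_unique)
  then show thesis using l C that by auto
qed

subsection \<open>Convolution with a strongly continuous semigroup\<close>

text \<open>The bound is on the right-hand side of the hypothesis rather than on \<open>u\<close>,
  because the estimate of the convolution term later subtracts a part of that side.\<close>

lemma gronwall:
  fixes u :: "real \<Rightarrow> real"
  assumes u: "continuous_on {0..T} u" and b: "b \<ge> 0" and t: "0 \<le> t" "t \<le> T"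
    and le: "\<And>t. 0 \<le> t \<Longrightarrow> t \<le> T \<Longrightarrow> u t \<le> a + b * integral {0..t} u"
  shows "a + b * integral {0..t} u \<le> a * exp (b * t)"
proof -
  define U where "U t = integral {0..t} u" for t
  \<comment> \<open>The right-hand side times its integrating factor; the hypothesis on
    \<open>u\<close> says precisely that its derivative is nonpositive.\<close>
  define v where "v t = exp (- b * t) * (a + b * U t)" for t
  have U: "(U has_real_derivative u s) (at s)" if "0 < s" "s < T" for s
  proof -
    have "(U has_real_derivative u s) (at s within {0..T})"
      unfolding U_def using integral_has_real_derivative[OF u, of s] that by auto
    then show ?thesis using that at_within_Icc_at by metis
  qed
  have "v t \<le> v 0"
  proof (rule DERIV_nonpos_imp_decreasing_open[OF t(1)])
    fix s assume s: "0 < s" "s < t"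
    have "(v has_real_derivative exp (- b * s) * (b * u s) + exp (- b * s) * (- b) * (a + b * U s)) (at s)"
      unfolding v_def using s t by (auto intro!: derivative_eq_intros U)
    moreover have "exp (- b * s) * (b * u s) + exp (- b * s) * (- b) * (a + b * U s)
        = exp (- b * s) * (b * (u s - (a + b * U s)))"
      by (simp add: algebra_simps)
    moreover have "u s \<le> a + b * U s"
      using le[of s] s t by (simp add: U_def)
    then have "exp (- b * s) * (b * (u s - (a + b * U s))) \<le> 0"
      using b by (auto intro!: mult_nonneg_nonpos)
    ultimately show "\<exists>y. (v has_real_derivative y) (at s) \<and> y \<le> 0" by metis
  next
    have "continuous_on {0..t} u" using u t by (auto intro: continuous_on_subset)
    then have "continuous_on {0..t} U"
      unfolding U_def by (intro indefinite_integral_continuous_1 integrable_continuous_real)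
    then show "continuous_on {0..t} v"
      unfolding v_def by (intro continuous_intros)
  qed
  then have "exp (- b * t) * (a + b * U t) \<le> a" by (simp add: v_def U_def)
  then have "exp (b * t) * (exp (- b * t) * (a + b * U t)) \<le> exp (b * t) * a"
    by (intro mult_left_mono) auto
  then show ?thesis
    by (simp add: U_def mult.assoc[symmetric] exp_add[symmetric] mult.commute)
qed

text \<open>Moves the variable endpoint into the integrand, so that continuity of a convolution in
  \<open>t\<close> becomes continuity of an integral over a fixed interval in a parameter.\<close>

lemma integral_eq_scaled_unit_integral:
  fixes f :: "real \<Rightarrow> 'a::real_normed_vector"
  assumes "t \<ge> 0"
  shows "integral {0..t} f = t *\<^sub>R integral {0..1} (\<lambda>r. f (t * r))"
proof (cases "t = 0")
  case False
  have "(\<lambda>x. x / t) ` {0..t} = {0..1}"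
    using assms False image_divide_atLeastAtMost[of t 0 t] by simp
  with integral_stretch_real[of t 0 t f] False assms show ?thesis by simp
qed simp

text \<open>All estimates are carried out over the reals. Complex scalars enter only at the end, as
  particular bounded real-linear maps.\<close>

locale exp_bounded_semigroup =
  fixes S :: "real \<Rightarrow> 'a::banach \<Rightarrow> 'a" and Q \<gamma> :: real
  assumes bounded_linear_S: "t \<ge> 0 \<Longrightarrow> bounded_linear (S t)"
    and S_0: "S 0 x = x"
    and S_add: "s \<ge> 0 \<Longrightarrow> t \<ge> 0 \<Longrightarrow> S (s + t) x = S s (S t x)"
    and strong: "((\<lambda>t. S t x) \<longlongrightarrow> x) (at_right 0)"
    and Q_pos: "Q > 0"
    and norm_S: "t \<ge> 0 \<Longrightarrow> norm (S t x) \<le> Q * exp (\<gamma> * t) * norm x"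
begin

text \<open>Local boundedness of the operators upgrades strong continuity at 0 to joint continuity,
  which the convolution integrand requires since time and vector vary together.\<close>

lemma tendsto_S:
  assumes t: "(t \<longlongrightarrow> t0) F" and x: "(x \<longlongrightarrow> x0) F"
    and ev: "eventually (\<lambda>k. t k \<ge> 0) F" and t0: "t0 \<ge> 0"
  shows "((\<lambda>k. S (t k) (x k)) \<longlongrightarrow> S t0 x0) F"
proof -
  \<comment> \<open>Factoring out the operator at the smaller time leaves the increment
    \<open>\<bar>p - q\<bar>\<close>, so one estimate covers the approach from the left and from the
    right.\<close>
  have *: "norm (S p x0 - S q x0) \<le> Q * exp (\<gamma> * min p q) * norm (S \<bar>p - q\<bar> x0 - x0)"
    if "p \<ge> 0" "q \<ge> 0" for p q
  proof -
    have "norm (S p x0 - S q x0) \<le> Q * exp (\<gamma> * q) * norm (S (p - q) x0 - x0)"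
      if "0 \<le> q" "q \<le> p" for p q
    proof -
      have "S p x0 - S q x0 = S q (S (p - q) x0 - x0)"
        using that S_add[of q "p - q" x0] bounded_linear_S[of q]
        by (simp add: bounded_linear.linear linear_diff)
      then show ?thesis using that norm_S[of q] by simp
    qed
    from this[of p q] this[of q p] show ?thesis
      using that by (cases "p \<le> q") (auto simp: norm_minus_commute min_def)
  qed
  have at0: "continuous (at 0 within {0..}) (\<lambda>h. S h x0)"
    using strong[of x0] unfolding continuous_within S_0 at_within_Ici_at_right .
  have d: "((\<lambda>k. S \<bar>t k - t0\<bar> x0) \<longlongrightarrow> S 0 x0) F"
    by (rule continuous_within_tendsto_compose[OF at0])
       (use t in \<open>auto intro!: tendsto_eq_intros\<close>)
  have lim: "((\<lambda>k. Q * exp (\<gamma> * t k) * norm (x k - x0) +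
      Q * exp (\<gamma> * min (t k) t0) * norm (S \<bar>t k - t0\<bar> x0 - x0)) \<longlongrightarrow> 0) F"
    using t x d by (auto simp: S_0 intro!: tendsto_eq_intros)
  have "((\<lambda>k. S (t k) (x k) - S t0 x0) \<longlongrightarrow> 0) F"
  proof (rule Lim_null_comparison[OF _ lim], use ev in eventually_elim)
    fix k assume k: "0 \<le> t k"
    have "S (t k) (x k) - S t0 x0 = S (t k) (x k - x0) + (S (t k) x0 - S t0 x0)"
      using bounded_linear_S[OF k] by (simp add: bounded_linear.linear linear_diff)
    then show "norm (S (t k) (x k) - S t0 x0) \<le> Q * exp (\<gamma> * t k) * norm (x k - x0) +
      Q * exp (\<gamma> * min (t k) t0) * norm (S \<bar>t k - t0\<bar> x0 - x0)"
      using norm_S[OF k, of "x k - x0"] *[OF k t0]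
      by (metis add_mono norm_triangle_le)
  qed
  then show ?thesis by (rule Lim_null[THEN iffD2])
qed

lemma continuous_on_S [continuous_intros]:
  assumes "continuous_on A t" "continuous_on A x" "\<And>a. a \<in> A \<Longrightarrow> t a \<ge> 0"
  shows "continuous_on A (\<lambda>a. S (t a) (x a))"
  unfolding continuous_on_def
proof
  fix a assume "a \<in> A"
  then show "((\<lambda>a. S (t a) (x a)) \<longlongrightarrow> S (t a) (x a)) (at a within A)"
    using assms by (intro tendsto_S) (auto simp: continuous_on_def eventually_at_filter)
qed

text \<open>The Duhamel term of the variation of constants formula.\<close>

definition convolution :: "(real \<Rightarrow> 'a) \<Rightarrow> real \<Rightarrow> 'a"
  where "convolution h t = integral {0..t} (\<lambda>s. S (t - s) (h s))"

lemma continuous_on_convolution_integrand: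
  assumes "continuous_on {0..t} h"
  shows "continuous_on {0..t} (\<lambda>s. S (t - s) (h s))"
  using assms by (auto intro!: continuous_intros)

lemma integrable_convolution:
  assumes "continuous_on {0..t} h"
  shows "(\<lambda>s. S (t - s) (h s)) integrable_on {0..t}"
  by (intro integrable_continuous_real continuous_on_convolution_integrand assms)

lemma continuous_on_convolution:
  assumes h: "continuous_on {0..} h"
  shows "continuous_on {0..} (convolution h)"
proof -
  have "continuous_on ({0..} \<times> cbox 0 1) (\<lambda>p::real \<times> real. h (fst p * snd p))"
    by (rule continuous_on_compose2[OF h]) (auto intro!: continuous_intros)
  moreover have "fst p - fst p * snd p \<ge> 0" if "p \<in> {0..} \<times> cbox 0 1" for p :: "real \<times> real"
    using that by (auto simp: mult_left_le)
  ultimately have "continuous_on ({0..} \<times> cbox 0 1) (\<lambda>(t, r). S (t - t * r) (h (t * r)))"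
    unfolding case_prod_beta by (intro continuous_on_S) (auto intro!: continuous_intros)
  then have "continuous_on {0..} (\<lambda>t. integral (cbox 0 1) (\<lambda>r. S (t - t * r) (h (t * r))))"
    by (rule integral_continuous_on_param)
  then have "continuous_on {0..} (\<lambda>t. t *\<^sub>R integral (cbox 0 1) (\<lambda>r. S (t - t * r) (h (t * r))))"
    by (intro continuous_on_scaleR continuous_on_id)
  moreover have "t *\<^sub>R integral (cbox 0 1) (\<lambda>r. S (t - t * r) (h (t * r))) = convolution h t" if "t \<in> {0..}" for t
    using that by (simp add: convolution_def integral_eq_scaled_unit_integral[of t])
  ultimately show ?thesis
    by (rule continuous_on_eq)
qed

text \<open>Pulling out \<open>exp (\<gamma> * t)\<close> leaves the weight
  \<open>exp (- \<gamma> * s)\<close> inside, so that Gronwall's inequality can be applied to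
  weighted norms with constants independent of \<open>t\<close>.\<close>

lemma norm_convolution:
  assumes "continuous_on {0..t} h" "continuous_on {0..t} b" "\<And>s. 0 \<le> s \<Longrightarrow> s \<le> t \<Longrightarrow> norm (h s) \<le> b s"
  shows "norm (convolution h t) \<le> Q * exp (\<gamma> * t) * integral {0..t} (\<lambda>s. exp (- \<gamma> * s) * b s)"
proof -
  have "norm (convolution h t) \<le> integral {0..t} (\<lambda>s. (Q * exp (\<gamma> * t)) * (exp (- \<gamma> * s) * b s))"
    unfolding convolution_def
  proof (rule integral_norm_bound_integral)
    show "(\<lambda>s. S (t - s) (h s)) integrable_on {0..t}"
      by (rule integrable_convolution[OF assms(1)])
    show "(\<lambda>s. Q * exp (\<gamma> * t) * (exp (- \<gamma> * s) * b s)) integrable_on {0..t}"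
      using assms by (intro integrable_continuous_real continuous_intros)
    fix s assume s: "s \<in> {0..t}"
    have "norm (S (t - s) (h s)) \<le> Q * exp (\<gamma> * (t - s)) * norm (h s)"
      using s by (intro norm_S) auto
    also have "\<dots> \<le> Q * exp (\<gamma> * (t - s)) * b s"
      using s assms Q_pos by (intro mult_left_mono) auto
    also have "exp (\<gamma> * (t - s)) = exp (\<gamma> * t) * exp (- \<gamma> * s)"
      by (simp add: exp_add[symmetric] algebra_simps)
    finally show "norm (S (t - s) (h s)) \<le> Q * exp (\<gamma> * t) * (exp (- \<gamma> * s) * b s)"
      by (simp add: mult_ac)
  qed
  then show ?thesis by simp
qed

text \<open>The factor \<open>1 / (l - \<gamma>)\<close> is what makes Picard's operator contract
  for large \<open>l\<close>.\<close>

lemma norm_convolution_exp: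
  assumes h: "continuous_on {0..t} h" and t: "t \<ge> 0" and l: "l > \<gamma>"
    and B: "B \<ge> 0" "\<And>s. 0 \<le> s \<Longrightarrow> s \<le> t \<Longrightarrow> norm (h s) \<le> B * exp (l * s)"
  shows "norm (convolution h t) \<le> Q * B / (l - \<gamma>) * exp (l * t)"
proof -
  have "((\<lambda>s. exp ((l - \<gamma>) * s)) has_integral exp ((l - \<gamma>) * t) / (l - \<gamma>) - exp ((l - \<gamma>) * 0) / (l - \<gamma>)) {0..t}"
    using t l by (intro fundamental_theorem_of_calculus)
      (auto intro!: derivative_eq_intros simp flip: has_real_derivative_iff_has_vector_derivative)
  then have I: "integral {0..t} (\<lambda>s. exp ((l - \<gamma>) * s)) = (exp ((l - \<gamma>) * t) - 1) / (l - \<gamma>)"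
    by (simp add: integral_unique diff_divide_distrib)
  have "norm (convolution h t) \<le> Q * exp (\<gamma> * t) * integral {0..t} (\<lambda>s. exp (- \<gamma> * s) * (B * exp (l * s)))"
    using B by (intro norm_convolution h continuous_intros)
  also have "(\<lambda>s. exp (- \<gamma> * s) * (B * exp (l * s))) = (\<lambda>s. B * exp ((l - \<gamma>) * s))"
    by (auto simp: exp_add[symmetric] algebra_simps)
  also have "Q * exp (\<gamma> * t) * integral {0..t} (\<lambda>s. B * exp ((l - \<gamma>) * s))
      = Q * B * (exp (\<gamma> * t) * ((exp ((l - \<gamma>) * t) - 1) / (l - \<gamma>)))"
    by (simp add: I)
  also have "\<dots> \<le> Q * B * (exp (\<gamma> * t) * (exp ((l - \<gamma>) * t) / (l - \<gamma>)))"
    using Q_pos B l by (intro mult_left_mono divide_right_mono) auto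
  also have "\<dots> = Q * B / (l - \<gamma>) * (exp (\<gamma> * t) * exp ((l - \<gamma>) * t))"
    by simp
  also have "exp (\<gamma> * t) * exp ((l - \<gamma>) * t) = exp (l * t)"
    by (simp add: exp_add[symmetric] algebra_simps)
  finally show ?thesis .
qed

lemma convolution_diff:
  assumes "continuous_on {0..t} h" "continuous_on {0..t} k"
  shows "convolution h t - convolution k t = convolution (\<lambda>s. h s - k s) t"
proof -
  have "integral {0..t} (\<lambda>s. S (t - s) (h s - k s)) = integral {0..t} (\<lambda>s. S (t - s) (h s) - S (t - s) (k s))"
    by (rule integral_cong) (auto simp: bounded_linear_S linear_diff bounded_linear.linear)
  then show ?thesis
    using assms by (simp add: convolution_def integral_diff integrable_convolution)
qed

lemma convolution_bounded_linear:
  assumes T: "bounded_linear T" "\<And>r x. r \<ge> 0 \<Longrightarrow> T (S r x) = S r (T x)" and h: "continuous_on {0..t} h"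
  shows "T (convolution h t) = convolution (\<lambda>s. T (h s)) t"
proof -
  have "T (convolution h t) = integral {0..t} (\<lambda>s. T (S (t - s) (h s)))"
    unfolding convolution_def using integral_linear[OF integrable_convolution[OF h] T(1)] by (simp add: o_def)
  also have "\<dots> = convolution (\<lambda>s. T (h s)) t"
    unfolding convolution_def by (rule integral_cong) (auto simp: T)
  finally show ?thesis .
qed

text \<open>The integral is split at \<open>u\<close>; the semigroup law pulls \<open>S t\<close>
  out of the first piece and a shift turns the second into a convolution. It serves both to isolate
  a short last piece and to restart a solution at a later time.\<close>

lemma convolution_add:
  assumes h: "continuous_on {0..} h" and tu: "t \<ge> 0" "u \<ge> 0"
  shows "convolution h (t + u) = S t (convolution h u) + convolution (\<lambda>s. h (s + u)) t"
proof -
  let ?f = "\<lambda>s. S (t + u - s) (h s)"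
  have "integral {0..u} ?f + integral {u..t + u} ?f = integral {0..t + u} ?f"
  proof (rule Henstock_Kurzweil_Integration.integral_combine)
    show "?f integrable_on {0..t + u}"
      by (rule integrable_convolution) (rule continuous_on_subset[OF h], auto)
  qed (use tu in auto)
  moreover have "integral {0..u} ?f = S t (convolution h u)"
  proof -
    have "S t (convolution h u) = integral {0..u} (\<lambda>s. S t (S (u - s) (h s)))"
      unfolding convolution_def
      using integral_linear[OF integrable_convolution[of u h] bounded_linear_S[of t]] tu
        continuous_on_subset[OF h, of "{0..u}"] by (simp add: o_def)
    also have "\<dots> = integral {0..u} ?f"
      using tu by (intro integral_cong) (auto simp: S_add[symmetric] algebra_simps)
    finally show ?thesis by simp
  qed
  moreover have "integral {u..t + u} ?f = convolution (\<lambda>s. h (s + u)) t"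
    using integral_shift_Icc_real[of 0 t ?f u] by (simp add: convolution_def o_def add.commute)
  ultimately show ?thesis by (simp add: convolution_def)
qed

text \<open>The factor \<open>t\<close> makes the last piece of a convolution small;
  \<open>\<bar>\<gamma>\<bar>\<close> makes the other factors monotone in \<open>t\<close> for
  either sign of \<open>\<gamma>\<close>.\<close>

lemma norm_convolution_const:
  assumes h: "continuous_on {0..t} h" and t: "t \<ge> 0"
    and M: "\<And>s. 0 \<le> s \<Longrightarrow> s \<le> t \<Longrightarrow> norm (h s) \<le> M"
  shows "norm (convolution h t) \<le> Q * exp (\<bar>\<gamma>\<bar> * t) * M * t"
proof -
  have "norm (integral {0..t} (\<lambda>s. S (t - s) (h s))) \<le> Q * exp (\<bar>\<gamma>\<bar> * t) * M * (t - 0)"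
  proof (rule integral_bound[OF t])
    show "continuous_on {0..t} (\<lambda>s. S (t - s) (h s))"
      by (rule continuous_on_convolution_integrand[OF h])
  next
    fix s assume s: "s \<in> {0..t}"
    have "norm (S (t - s) (h s)) \<le> Q * exp (\<gamma> * (t - s)) * norm (h s)"
      using s by (intro norm_S) auto
    also have "\<dots> \<le> Q * exp (\<bar>\<gamma>\<bar> * t) * M"
      using s M Q_pos by (intro mult_mono) (auto intro!: mult_mono simp: abs_ge_self)
    finally show "norm (S (t - s) (h s)) \<le> Q * exp (\<bar>\<gamma>\<bar> * t) * M" .
  qed
  then show ?thesis by (simp add: convolution_def)
qed

text \<open>Splitting off the last piece of length \<open>e\<close> writes the convolution as \<open>S e\<close> applied to a bounded
  set plus an error of order \<open>e\<close>, which gives total boundedness.\<close>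

lemma compact_convolutions:
  assumes cpt: "\<And>t B. t > 0 \<Longrightarrow> bounded B \<Longrightarrow> compact (closure (S t ` B))"
    and T: "T > 0" and M: "M \<ge> 0"
  shows "compact (closure {convolution h T | h. continuous_on {0..} h \<and> (\<forall>s\<in>{0..T}. norm (h s) \<le> M)})"
    (is "compact (closure ?V)")
proof -
  define N where "N = Q * exp (\<bar>\<gamma>\<bar> * T) * M"
  have N: "N \<ge> 0" using Q_pos M by (simp add: N_def)
  have bound: "norm (convolution h t) \<le> N * t"
    if "continuous_on {0..} h" "\<And>s. 0 \<le> s \<Longrightarrow> s \<le> t \<Longrightarrow> norm (h s) \<le> M" "0 \<le> t" "t \<le> T" for h t
  proof -
    have "norm (convolution h t) \<le> Q * exp (\<bar>\<gamma>\<bar> * t) * M * t"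
      using that by (intro norm_convolution_const continuous_on_subset[OF that(1)]) auto
    also have "\<dots> \<le> N * t"
      unfolding N_def using that M Q_pos by (intro mult_right_mono mult_left_mono) (auto intro!: mult_left_mono)
    finally show ?thesis .
  qed
  have "\<exists>k. finite k \<and> closure ?V \<subseteq> (\<Union>x\<in>k. ball x e)" if e: "e > 0" for e
  proof -
    \<comment> \<open>The length of the last piece, chosen to keep its contribution below
      \<open>e / 4\<close>; \<open>N + 1\<close> guards against \<open>N = 0\<close>.\<close>
    define d where "d = min T (e / (4 * (N + 1)))"
    have d: "0 < d" "d \<le> T" using T e N by (auto simp: d_def)
    have "N * d \<le> N * (e / (4 * (N + 1)))"
      using N by (intro mult_left_mono) (auto simp: d_def)
    also have "\<dots> \<le> e / 4" using N e by (simp add: field_simps)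
    finally have Nd: "N * d \<le> e / 4" .
    have "compact (closure (S d ` cball 0 (N * T)))" using cpt d by auto
    then obtain k where k: "finite k" "closure (S d ` cball 0 (N * T)) \<subseteq> (\<Union>x\<in>k. ball x (e / 2))"
      using e unfolding compact_eq_totally_bounded by (meson half_gt_zero)
    \<comment> \<open>The net contributes \<open>e / 2\<close> and the last piece
      \<open>e / 4\<close>. Closed balls of a radius below \<open>e\<close> absorb the closure of
      the set as well.\<close>
    have "?V \<subseteq> (\<Union>x\<in>k. cball x (3 * e / 4))"
    proof
      fix v assume "v \<in> ?V"
      then obtain h where v: "v = convolution h T" and h: "continuous_on {0..} h"
        "\<And>s. 0 \<le> s \<Longrightarrow> s \<le> T \<Longrightarrow> norm (h s) \<le> M" by auto
      have split: "v = S d (convolution h (T - d)) + convolution (\<lambda>s. h (s + (T - d))) d"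
        using convolution_add[OF h(1), of d "T - d"] d v by simp
      have h': "continuous_on {0..} (\<lambda>s. h (s + (T - d)))"
        using d by (intro continuous_on_compose2[OF h(1)] continuous_intros) auto
      have "norm (convolution (\<lambda>s. h (s + (T - d))) d) \<le> N * d"
        using d h h' by (intro bound) auto
      moreover have "norm (convolution h (T - d)) \<le> N * T"
      proof -
        have "norm (convolution h (T - d)) \<le> N * (T - d)" using d h by (intro bound) auto
        also have "\<dots> \<le> N * T" using N d by (intro mult_left_mono) auto
        finally show ?thesis .
      qed
      then have "S d (convolution h (T - d)) \<in> closure (S d ` cball 0 (N * T))"
        by (intro subsetD[OF closure_subset]) auto
      then obtain x where x: "x \<in> k" "dist x (S d (convolution h (T - d))) < e / 2"
        using k by auto
      moreover have "dist x v \<le> dist x (S d (convolution h (T - d))) + norm (convolution (\<lambda>s. h (s + (T - d))) d)"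
        unfolding split by (metis add_diff_cancel_left' dist_commute dist_norm dist_triangle)
      ultimately have "dist x v \<le> 3 * e / 4" using Nd by linarith
      then show "v \<in> (\<Union>x\<in>k. cball x (3 * e / 4))" using x by auto
    qed
    moreover have "closed (\<Union>x\<in>k. cball x (3 * e / 4))" using k by auto
    ultimately have "closure ?V \<subseteq> (\<Union>x\<in>k. cball x (3 * e / 4))" by (rule closure_minimal)
    also have "\<dots> \<subseteq> (\<Union>x\<in>k. ball x e)" using e by force
    finally show ?thesis using k by blast
  qed
  then show ?thesis
    unfolding compact_eq_totally_bounded by (simp add: complete_eq_closed)
qed

end

subsection \<open>Mild solutions of semilinear equations\<close>

locale semilinear_equation = exp_bounded_semigroup +
  fixes g :: "real \<Rightarrow> 'a \<Rightarrow> 'a" and L g1 g2 :: real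
  assumes continuous_g: "continuous_on ({0..} \<times> UNIV) (\<lambda>(t, y). g t y)"
    and L_nonneg: "L \<ge> 0"
    and lipschitz_g: "t \<ge> 0 \<Longrightarrow> norm (g t y - g t z) \<le> L * norm (y - z)"
    and g1_nonneg: "g1 \<ge> 0" and g2_nonneg: "g2 \<ge> 0"
    and norm_g: "t \<ge> 0 \<Longrightarrow> norm (g t y) \<le> g1 + g2 * norm y"
begin

text \<open>Here the initial value is a parameter, in contrast to \<open>mild_solution\<close>;
  integrability is left out since it follows from continuity of the forcing.\<close>

definition mild :: "'a \<Rightarrow> (real \<Rightarrow> 'a) \<Rightarrow> bool"
  where "mild x y \<longleftrightarrow> continuous_on {0..} y \<and> (\<forall>t\<ge>0. y t = S t x + convolution (\<lambda>s. g s (y s)) t)"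

lemma continuous_on_forcing:
  assumes "continuous_on A y" "A \<subseteq> {0..}"
  shows "continuous_on A (\<lambda>s. g s (y s))"
proof -
  have "continuous_on A (\<lambda>s. (s, y s))"
    by (intro continuous_on_Pair continuous_on_id assms)
  from continuous_on_compose2[OF continuous_g this] show ?thesis
    using assms(2) by auto
qed

lemma mild_forcing_continuous:
  assumes "mild x y" "A \<subseteq> {0..}"
  shows "continuous_on A (\<lambda>s. g s (y s))"
  using assms by (intro continuous_on_forcing) (auto simp: mild_def intro: continuous_on_subset)

text \<open>Picard's operator is a contraction of the bounded continuous functions after the rescaling
  \<open>y t = exp (l * t) * z t\<close> with \<open>l\<close> large.\<close>

lemma mild_exists: "\<exists>y. mild x y"
proof -
  \<comment> \<open>The gap \<open>l - \<gamma>\<close> is at least \<open>Q * L + 1\<close>, which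
    puts the contraction ratio below 1. The maximum with 0 gives \<open>l \<ge> 0\<close>, so
    \<open>exp (l * s)\<close> dominates the constant part \<open>g1\<close> of the growth
    bound.\<close>
  define l where "l = max \<gamma> 0 + Q * L + 1"
  have l: "l > \<gamma>" "l \<ge> 0" and ratio: "0 \<le> Q * L / (l - \<gamma>)" "Q * L / (l - \<gamma>) < 1"
  proof -
    have "Q * L \<ge> 0" using Q_pos L_nonneg by simp
    then show "l > \<gamma>" "l \<ge> 0" "0 \<le> Q * L / (l - \<gamma>)" "Q * L / (l - \<gamma>) < 1"
      by (auto simp: l_def max_def field_simps)
  qed
  define F where "F z s = g s (exp (l * s) *\<^sub>R apply_bcontfun z s)" for z s
  define P where "P z t = exp (- l * t) *\<^sub>R (S t x + convolution (F z) t)" for z t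
  have F_cont: "continuous_on A (F z)" if "A \<subseteq> {0..}" for A z
    unfolding F_def using that by (intro continuous_on_forcing continuous_intros) auto
  have F_bound: "norm (F z s) \<le> (g1 + g2 * norm z) * exp (l * s)" if "s \<ge> 0" for z s
  proof -
    have "norm (F z s) \<le> g1 + g2 * (exp (l * s) * norm (z s))"
      unfolding F_def using norm_g[OF that, of "exp (l * s) *\<^sub>R z s"] by simp
    also have "\<dots> \<le> g1 * exp (l * s) + g2 * (exp (l * s) * norm z)"
      using that l g1_nonneg g2_nonneg norm_bounded[of z s] mult_left_mono[of 1 "exp (l * s)" g1]
      by (intro add_mono mult_left_mono) auto
    finally show ?thesis by (simp add: algebra_simps)
  qed
  have P_cont: "continuous_on {0..} (P z)" for z
    unfolding P_def
    by (intro continuous_intros continuous_on_convolution F_cont) auto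
  have P_bound: "norm (P z t) \<le> Q * norm x + Q * (g1 + g2 * norm z) / (l - \<gamma>)" if t: "t \<ge> 0" for z t
  proof -
    have "norm (S t x) \<le> Q * exp (l * t) * norm x"
    proof -
      have "norm (S t x) \<le> Q * exp (\<gamma> * t) * norm x" by (rule norm_S[OF t])
      also have "\<dots> \<le> Q * exp (l * t) * norm x"
        using t l Q_pos by (intro mult_right_mono mult_left_mono) (auto intro!: mult_right_mono)
      finally show ?thesis .
    qed
    moreover have "norm (convolution (F z) t) \<le> Q * (g1 + g2 * norm z) / (l - \<gamma>) * exp (l * t)"
      using t l F_bound g1_nonneg g2_nonneg by (intro norm_convolution_exp F_cont) auto
    ultimately have "norm (S t x + convolution (F z) t)
        \<le> exp (l * t) * (Q * norm x + Q * (g1 + g2 * norm z) / (l - \<gamma>))"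
      by (intro norm_triangle_le) (simp add: algebra_simps)
    then have "exp (- l * t) * norm (S t x + convolution (F z) t)
        \<le> exp (- l * t) * (exp (l * t) * (Q * norm x + Q * (g1 + g2 * norm z) / (l - \<gamma>)))"
      by (intro mult_left_mono) auto
    then show ?thesis
      by (simp add: P_def mult.assoc[symmetric] exp_add[symmetric])
  qed
  have P_lipschitz: "norm (P z t - P w t) \<le> Q * L / (l - \<gamma>) * dist z w" if t: "t \<ge> 0" for z w t
  proof -
    have eq: "P z t - P w t = exp (- l * t) *\<^sub>R convolution (\<lambda>s. F z s - F w s) t"
      by (simp add: P_def algebra_simps flip: convolution_diff[OF F_cont F_cont])
    have le: "norm (convolution (\<lambda>s. F z s - F w s) t) \<le> Q * (L * dist z w) / (l - \<gamma>) * exp (l * t)"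
    proof (rule norm_convolution_exp)
      fix s :: real assume s: "0 \<le> s"
      have "norm (F z s - F w s) \<le> L * norm (exp (l * s) *\<^sub>R z s - exp (l * s) *\<^sub>R w s)"
        unfolding F_def by (rule lipschitz_g[OF s])
      also have "\<dots> = L * (exp (l * s) * dist (z s) (w s))"
        by (simp add: dist_norm flip: scaleR_diff_right)
      also have "\<dots> \<le> L * (exp (l * s) * dist z w)"
        using L_nonneg dist_bounded[of z s w] by (intro mult_left_mono) auto
      finally show "norm (F z s - F w s) \<le> L * dist z w * exp (l * s)" by (simp add: mult_ac)
    qed (use t l L_nonneg in \<open>auto intro!: continuous_intros F_cont\<close>)
    have "norm (P z t - P w t) = exp (- l * t) * norm (convolution (\<lambda>s. F z s - F w s) t)"
      by (simp add: eq)
    also have "\<dots> \<le> exp (- l * t) * (Q * (L * dist z w) / (l - \<gamma>) * exp (l * t))"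
      by (intro mult_left_mono le) simp
    also have "\<dots> = Q * L / (l - \<gamma>) * dist z w * (exp (- l * t) * exp (l * t))"
      by simp
    also have "exp (- l * t) * exp (l * t) = 1" by (simp add: exp_add[symmetric])
    finally show ?thesis by simp
  qed
  \<comment> \<open>Bounded continuous functions are defined on the whole line, so
    \<open>P z\<close> is extended to negative times by its value at 0.\<close>
  have ex: "\<exists>w. apply_bcontfun w = (\<lambda>t. P z (max 0 t))" for z
  proof -
    have "continuous_on UNIV (\<lambda>t. P z (max 0 t))"
      by (rule continuous_on_compose2[OF P_cont]) (auto intro!: continuous_intros)
    moreover have "bounded (range (\<lambda>t. P z (max 0 t)))"
      using P_bound[of "max 0 _" z] by (intro boundedI) auto
    ultimately show ?thesis
      by (metis (mono_tags, lifting) bcontfunE bcontfun_def mem_Collect_eq)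
  qed
  then obtain \<Phi> where \<Phi>: "\<And>z t. apply_bcontfun (\<Phi> z) t = P z (max 0 t)" by metis
  have "\<exists>!z. \<Phi> z = z"
  proof (rule banach_fix_type[OF ratio], intro allI)
    fix z w
    show "dist (\<Phi> z) (\<Phi> w) \<le> Q * L / (l - \<gamma>) * dist z w"
      by (rule dist_bound) (use P_lipschitz[of "max 0 _" z w] in \<open>simp add: \<Phi> dist_norm\<close>)
  qed
  then obtain z where z: "\<Phi> z = z" by blast
  define y where "y t = exp (l * t) *\<^sub>R z t" for t
  have "y t = S t x + convolution (\<lambda>s. g s (y s)) t" if "t \<ge> 0" for t
  proof -
    have "z t = P z t" using \<Phi>[of z t] z that by simp
    then have "y t = (exp (l * t) * exp (- l * t)) *\<^sub>R (S t x + convolution (F z) t)"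
      by (simp add: y_def P_def)
    also have "exp (l * t) * exp (- l * t) = 1" by (simp add: exp_add[symmetric])
    also have "F z = (\<lambda>s. g s (y s))" by (auto simp: F_def y_def)
    finally show ?thesis by simp
  qed
  moreover have "continuous_on {0..} y" unfolding y_def by (intro continuous_intros) auto
  ultimately show ?thesis unfolding mild_def by blast
qed

text \<open>Gronwall's inequality for the difference of the solutions, weighted by
  \<open>exp (- \<gamma> * s)\<close>. It yields uniqueness and the continuity of the map from
  initial value to end value.\<close>

lemma mild_lipschitz:
  assumes y: "mild x y" and z: "mild x' z" and t: "t \<ge> 0"
  shows "norm (y t - z t) \<le> Q * norm (x - x') * exp ((\<gamma> + Q * L) * t)"
proof -
  define u where "u s = exp (- \<gamma> * s) * norm (y s - z s)" for s
  have yz: "continuous_on {0..r} y" "continuous_on {0..r} z" for r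
    using y z by (auto simp: mild_def intro: continuous_on_subset)
  have u: "continuous_on {0..t} u" unfolding u_def by (intro continuous_intros yz)
  have le: "u r \<le> Q * norm (x - x') + Q * L * integral {0..r} u" if r: "0 \<le> r" "r \<le> t" for r
  proof -
    have c: "continuous_on {0..r} (\<lambda>s. g s (y s))" "continuous_on {0..r} (\<lambda>s. g s (z s))"
      using mild_forcing_continuous[OF y] mild_forcing_continuous[OF z] by auto
    have "y r - z r = S r (x - x') + convolution (\<lambda>s. g s (y s) - g s (z s)) r"
      using y z r linear_diff[OF bounded_linear.linear[OF bounded_linear_S[OF r(1)]], of x x']
      by (simp add: mild_def flip: convolution_diff[OF c])
    moreover have "norm (convolution (\<lambda>s. g s (y s) - g s (z s)) r)
        \<le> Q * exp (\<gamma> * r) * integral {0..r} (\<lambda>s. exp (- \<gamma> * s) * (L * norm (y s - z s)))"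
      using lipschitz_g by (intro norm_convolution continuous_intros c yz) auto
    moreover have "(\<lambda>s. exp (- \<gamma> * s) * (L * norm (y s - z s))) = (\<lambda>s. L * u s)"
      by (auto simp: u_def)
    ultimately have "norm (y r - z r) \<le> Q * exp (\<gamma> * r) * norm (x - x') + Q * exp (\<gamma> * r) * (L * integral {0..r} u)"
      using norm_S[OF r(1), of "x - x'"] by (simp add: norm_triangle_le)
    also have "\<dots> = exp (\<gamma> * r) * (Q * norm (x - x') + Q * L * integral {0..r} u)"
      by (simp add: algebra_simps)
    finally have "u r \<le> exp (- \<gamma> * r) * (exp (\<gamma> * r) * (Q * norm (x - x') + Q * L * integral {0..r} u))"
      unfolding u_def by (intro mult_left_mono) auto
    then show ?thesis by (simp add: mult.assoc[symmetric] exp_add[symmetric])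
  qed
  have "u t \<le> Q * norm (x - x') * exp (Q * L * t)"
    using gronwall[OF u _ t order.refl le] le[OF t order.refl] Q_pos L_nonneg by simp
  then have "exp (\<gamma> * t) * u t \<le> exp (\<gamma> * t) * (Q * norm (x - x') * exp (Q * L * t))"
    by (intro mult_left_mono) auto
  also have "\<dots> = Q * norm (x - x') * (exp (\<gamma> * t) * exp (Q * L * t))"
    by simp
  also have "exp (\<gamma> * t) * exp (Q * L * t) = exp ((\<gamma> + Q * L) * t)"
    by (simp add: exp_add[symmetric] distrib_right)
  finally show ?thesis
    by (simp add: u_def mult.assoc[symmetric] exp_add[symmetric])
qed

lemma mild_unique:
  assumes "mild x y" "mild x z" "t \<ge> 0"
  shows "y t = z t"
  using mild_lipschitz[OF assms] by simp

text \<open>On the horizon \<open>T\<close>, \<open>C\<close> is the contribution of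
  \<open>g1\<close> to the weighted norm of a solution, made uniform in \<open>t\<close> by
  integrating up to \<open>T\<close>.\<close>

context
  fixes T C :: real
  defines "C \<equiv> Q * g1 * integral {0..T} (\<lambda>s. exp (- \<gamma> * s))"
begin

lemma C_nonneg: "C \<ge> 0"
  unfolding C_def using Q_pos g1_nonneg by (intro mult_nonneg_nonneg integral_nonneg integrable_continuous_real continuous_intros) auto

text \<open>Bounding the convolution itself, not the whole solution, keeps the term
  \<open>- Q * norm x\<close>. The coefficient of \<open>norm x\<close> is thus
  \<open>Q * exp (\<gamma> * t) * (exp (Q * g2 * t) - 1)\<close>, the one in the smallness
  condition.\<close>

lemma norm_mild_convolution:
  assumes y: "mild x y" and t: "0 \<le> t" "t \<le> T"
  shows "norm (convolution (\<lambda>s. g s (y s)) t) \<le> exp (\<gamma> * t) * ((Q * norm x + C) * exp (Q * g2 * t) - Q * norm x)"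
proof -
  define u where "u s = exp (- \<gamma> * s) * norm (y s)" for s
  have yc: "continuous_on {0..r} y" for r
    using y by (auto simp: mild_def intro: continuous_on_subset)
  have u: "continuous_on {0..r} u" for r unfolding u_def by (intro continuous_intros yc)
  have conv: "norm (convolution (\<lambda>s. g s (y s)) r) \<le> exp (\<gamma> * r) * (C + Q * g2 * integral {0..r} u)"
    if r: "0 \<le> r" "r \<le> T" for r
  proof -
    have int: "(\<lambda>s. exp (- \<gamma> * s)) integrable_on {0..r}" for r
      by (intro integrable_continuous_real continuous_intros)
    have "norm (convolution (\<lambda>s. g s (y s)) r)
        \<le> Q * exp (\<gamma> * r) * integral {0..r} (\<lambda>s. exp (- \<gamma> * s) * (g1 + g2 * norm (y s)))"
      using norm_g mild_forcing_continuous[OF y] by (intro norm_convolution continuous_intros yc) auto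
    also have "(\<lambda>s. exp (- \<gamma> * s) * (g1 + g2 * norm (y s))) = (\<lambda>s. g1 * exp (- \<gamma> * s) + g2 * u s)"
      by (auto simp: u_def algebra_simps)
    also have "integral {0..r} \<dots> = g1 * integral {0..r} (\<lambda>s. exp (- \<gamma> * s)) + g2 * integral {0..r} u"
      by (subst integral_add) (auto intro!: integrable_continuous_real continuous_intros u)
    also have "\<dots> \<le> g1 * integral {0..T} (\<lambda>s. exp (- \<gamma> * s)) + g2 * integral {0..r} u"
      using r g1_nonneg by (intro add_right_mono mult_left_mono integral_subset_le int) auto
    finally show ?thesis using Q_pos by (simp add: C_def algebra_simps)
  qed
  have le: "u r \<le> (Q * norm x + C) + Q * g2 * integral {0..r} u" if r: "0 \<le> r" "r \<le> t" for r
  proof -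
    have "y r = S r x + convolution (\<lambda>s. g s (y s)) r" using y r by (simp add: mild_def)
    then have "norm (y r) \<le> Q * exp (\<gamma> * r) * norm x + exp (\<gamma> * r) * (C + Q * g2 * integral {0..r} u)"
      using norm_S[OF r(1), of x] conv[of r] r t by (simp add: norm_triangle_le)
    also have "\<dots> = exp (\<gamma> * r) * (Q * norm x + C + Q * g2 * integral {0..r} u)"
      by (simp add: algebra_simps)
    finally have "u r \<le> exp (- \<gamma> * r) * (exp (\<gamma> * r) * (Q * norm x + C + Q * g2 * integral {0..r} u))"
      unfolding u_def by (intro mult_left_mono) auto
    then show ?thesis by (simp add: mult.assoc[symmetric] exp_add[symmetric])
  qed
  have "Q * norm x + C + Q * g2 * integral {0..t} u \<le> (Q * norm x + C) * exp (Q * g2 * t)"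
    using Q_pos g2_nonneg by (intro gronwall[OF u _ t(1) order.refl le]) auto
  then have "C + Q * g2 * integral {0..t} u \<le> (Q * norm x + C) * exp (Q * g2 * t) - Q * norm x"
    by linarith
  then have "exp (\<gamma> * t) * (C + Q * g2 * integral {0..t} u)
      \<le> exp (\<gamma> * t) * ((Q * norm x + C) * exp (Q * g2 * t) - Q * norm x)"
    by (rule mult_left_mono) simp
  with conv[OF t] show ?thesis by linarith
qed

text \<open>A bound uniform in \<open>t\<close>, used to bound the forcing along all solutions that
  start in a given ball.\<close>

lemma norm_mild:
  assumes y: "mild x y" and t: "0 \<le> t" "t \<le> T"
  shows "norm (y t) \<le> exp (\<bar>\<gamma>\<bar> * T) * ((Q * norm x + C) * exp (Q * g2 * T))"
proof -
  have "y t = S t x + convolution (\<lambda>s. g s (y s)) t" using y t by (simp add: mild_def)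
  then have "norm (y t) \<le> Q * exp (\<gamma> * t) * norm x + exp (\<gamma> * t) * ((Q * norm x + C) * exp (Q * g2 * t) - Q * norm x)"
    using norm_S[OF t(1), of x] norm_mild_convolution[OF y t] by (simp add: norm_triangle_le)
  also have "\<dots> = exp (\<gamma> * t) * ((Q * norm x + C) * exp (Q * g2 * t))"
    by (simp add: algebra_simps)
  also have "\<dots> \<le> exp (\<bar>\<gamma>\<bar> * T) * ((Q * norm x + C) * exp (Q * g2 * T))"
    using t Q_pos g2_nonneg C_nonneg
    by (intro mult_mono) (auto intro!: mult_mono mult_left_mono)
  finally show ?thesis .
qed

end

text \<open>A fixed point of \<open>R \<circ> P\<close>, where \<open>P x\<close> is the convolution term at time \<open>T\<close> of the solution
  starting at \<open>x\<close>, is an initial value with \<open>R (y T - S T x) = x\<close>; for \<open>R\<close> the resolvent this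
  reads \<open>y T = c x\<close>.\<close>

lemma mild_resolvent_fixed_point:
  assumes cpt: "\<And>t B. t > 0 \<Longrightarrow> bounded B \<Longrightarrow> compact (closure (S t ` B))"
    and T: "T > 0" and R: "bounded_linear R"
    and small: "Q * onorm R * exp (\<gamma> * T) * (exp (Q * g2 * T) - 1) < 1"
  obtains x y where "mild x y" "R (convolution (\<lambda>s. g s (y s)) T) = x"
proof -
  obtain Y where Y: "\<And>x. mild x (Y x)" using mild_exists by metis
  define P where "P x = convolution (\<lambda>s. g s (Y x s)) T" for x
  define C where "C = Q * g1 * integral {0..T} (\<lambda>s. exp (- \<gamma> * s))"
  \<comment> \<open>The map \<open>R \<circ> P\<close> grows at most affinely, with slope
    \<open>q < 1\<close> and offset \<open>B\<close>; \<open>\<rho>\<close> solves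
    \<open>q * \<rho> + B = \<rho>\<close>, so the ball of this radius is mapped into
    itself.\<close>
  define q where "q = Q * onorm R * exp (\<gamma> * T) * (exp (Q * g2 * T) - 1)"
  define B where "B = onorm R * exp (\<gamma> * T) * C * exp (Q * g2 * T)"
  define \<rho> where "\<rho> = B / (1 - q)"
  have R0: "onorm R \<ge> 0" by (rule onorm_pos_le[OF R])
  have C: "C \<ge> 0" unfolding C_def by (rule C_nonneg)
  have q: "0 \<le> q" "q < 1" using small Q_pos R0 g2_nonneg T by (auto simp: q_def)
  have B: "B \<ge> 0" using R0 C by (simp add: B_def)
  have \<rho>: "\<rho> \<ge> 0" "q * \<rho> + B = \<rho>" using q B by (auto simp: \<rho>_def field_simps)
  have RP: "norm (R (P x)) \<le> q * norm x + B" for x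
  proof -
    have "norm (R (P x)) \<le> onorm R * norm (P x)" by (rule onorm[OF R])
    also have "\<dots> \<le> onorm R * (exp (\<gamma> * T) * ((Q * norm x + C) * exp (Q * g2 * T) - Q * norm x))"
      unfolding P_def C_def using norm_mild_convolution[OF Y, of T T] T R0 by (intro mult_left_mono) auto
    also have "\<dots> = q * norm x + B" by (simp add: q_def B_def algebra_simps)
    finally show ?thesis .
  qed
  have ball: "R (P x) \<in> cball 0 \<rho>" if "x \<in> cball 0 \<rho>" for x
  proof -
    have "norm (R (P x)) \<le> q * norm x + B" by (rule RP)
    also have "\<dots> \<le> q * \<rho> + B" using that q by (intro add_right_mono mult_left_mono) auto
    finally show ?thesis using \<rho> by simp
  qed
  have P_eq: "P x = Y x T - S T x" for x
    using Y[of x] T by (simp add: mild_def P_def)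
  have "(Q * exp ((\<gamma> + Q * L) * T))-lipschitz_on UNIV (\<lambda>x. Y x T)"
  proof (rule lipschitz_onI)
    show "dist (Y x T) (Y x' T) \<le> Q * exp ((\<gamma> + Q * L) * T) * dist x x'" for x x'
      using mild_lipschitz[OF Y[of x] Y[of x'], of T] T by (simp add: dist_norm mult_ac)
  qed (use Q_pos in auto)
  then have "continuous_on UNIV (\<lambda>x. Y x T)" by (rule lipschitz_on_continuous_on)
  then have P_cont: "continuous_on A P" for A
    unfolding P_eq using T
    by (auto intro!: continuous_intros intro: continuous_on_subset)
  \<comment> \<open>Bounds the forcing on the time interval along every solution starting in the
    ball, which places \<open>P x\<close> in the relatively compact set \<open>?V\<close>.\<close>
  define M where "M = g1 + g2 * (exp (\<bar>\<gamma>\<bar> * T) * ((Q * \<rho> + C) * exp (Q * g2 * T)))"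
  have M: "M \<ge> 0" using g1_nonneg g2_nonneg Q_pos \<rho> C by (simp add: M_def)
  let ?V = "{convolution h T | h. continuous_on {0..} h \<and> (\<forall>s\<in>{0..T}. norm (h s) \<le> M)}"
  have V: "compact (closure ?V)"
    by (rule compact_convolutions[OF cpt T M])
  have "P x \<in> ?V" if x: "x \<in> cball 0 \<rho>" for x
  proof -
    have "norm (g s (Y x s)) \<le> M" if s: "s \<in> {0..T}" for s
    proof -
      have "norm (g s (Y x s)) \<le> g1 + g2 * norm (Y x s)" using s by (intro norm_g) auto
      also have "norm (Y x s) \<le> exp (\<bar>\<gamma>\<bar> * T) * ((Q * norm x + C) * exp (Q * g2 * T))"
        unfolding C_def using norm_mild[OF Y, of s T] s by auto
      also have "\<dots> \<le> exp (\<bar>\<gamma>\<bar> * T) * ((Q * \<rho> + C) * exp (Q * g2 * T))"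
        using x Q_pos by (intro mult_left_mono mult_right_mono add_right_mono) auto
      finally show ?thesis using g2_nonneg by (simp add: M_def mult_left_mono)
    qed
    then show ?thesis unfolding P_def using mild_forcing_continuous[OF Y, of "{0..}" x] by blast
  qed
  then have P_V: "P x \<in> closure ?V" if "x \<in> cball 0 \<rho>" for x
    using that closure_subset by blast
  have "compact (R ` closure ?V)"
    by (intro compact_continuous_image linear_continuous_on R V)
  \<comment> \<open>Schauder's theorem asks for a compact set inside the convex one, hence the
    intersection with the ball.\<close>
  then have cpt': "compact (R ` closure ?V \<inter> cball 0 \<rho>)"
    by (rule compact_Int_closed) simp
  have cont: "continuous_on (cball 0 \<rho>) (\<lambda>x. R (P x))"
    by (rule bounded_linear.continuous_on[OF R P_cont])
  have "(\<lambda>x. R (P x)) \<in> cball 0 \<rho> \<rightarrow> R ` closure ?V \<inter> cball 0 \<rho>"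
    using ball P_V by blast
  then obtain x where "R (P x) = x"
    by (rule schauder[OF convex_cball _ cpt' Int_lower2 cont, rotated]) (use \<rho> in auto)
  then show thesis using that Y unfolding P_def by blast
qed

text \<open>The semigroup law and \<open>convolution_add\<close> both factor through
  \<open>S t\<close>; the arguments of \<open>S t\<close> add up to the value of the solution at
  \<open>u\<close>.\<close>

lemma mild_shift:
  assumes y: "mild x y" and u: "u \<ge> 0" and t: "t \<ge> 0"
  shows "y (t + u) = S t (y u) + convolution (\<lambda>s. g (s + u) (y (s + u))) t"
proof -
  have "y (t + u) = S (t + u) x + convolution (\<lambda>s. g s (y s)) (t + u)"
    using y u t by (simp add: mild_def)
  also have "\<dots> = S t (S u x) + (S t (convolution (\<lambda>s. g s (y s)) u) + convolution (\<lambda>s. g (s + u) (y (s + u))) t)"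
    using convolution_add[OF mild_forcing_continuous[OF y], of t u] u t by (simp add: S_add)
  also have "\<dots> = S t (S u x + convolution (\<lambda>s. g s (y s)) u) + convolution (\<lambda>s. g (s + u) (y (s + u))) t"
    using linear_add[OF bounded_linear.linear[OF bounded_linear_S[OF t]]] by simp
  also have "S u x + convolution (\<lambda>s. g s (y s)) u = y u"
    using y u by (simp add: mild_def)
  finally show ?thesis .
qed

text \<open>The function \<open>T' (y (t + u))\<close> solves the same equation with the same
  initial value, because \<open>T\<close> commutes with the semigroup and the symmetry of
  \<open>g\<close> moves \<open>T\<close> through the forcing. Uniqueness identifies it with
  \<open>y\<close>.\<close>

lemma mild_periodic:
  assumes y: "mild x y" and u: "u \<ge> 0" and yu: "y u = T x"
    and T: "bounded_linear T" "\<And>r x. r \<ge> 0 \<Longrightarrow> T (S r x) = S r (T x)"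
    and T': "bounded_linear T'" "\<And>x. T' (T x) = x" "\<And>x. T (T' x) = x"
    and g: "\<And>t y. t \<ge> 0 \<Longrightarrow> g (t + u) (T y) = T (g t y)"
    and t: "t \<ge> 0"
  shows "y (t + u) = T (y t)"
proof -
  define w where "w t = T' (y (t + u))" for t
  have "continuous_on {0..} (\<lambda>t. y (t + u))"
    by (rule continuous_on_compose2[of "{0..}" y]) (use y u in \<open>auto simp: mild_def intro!: continuous_intros\<close>)
  then have w: "continuous_on {0..} w"
    unfolding w_def by (rule bounded_linear.continuous_on[OF T'(1)])
  have "w r = S r x + convolution (\<lambda>s. g s (w s)) r" if r: "r \<ge> 0" for r
  proof -
    \<comment> \<open>Since \<open>y (s + u) = T (w s)\<close>, the symmetry of \<open>g\<close>
      applies pointwise under the integral.\<close>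
    have "convolution (\<lambda>s. g (s + u) (y (s + u))) r = convolution (\<lambda>s. T (g s (w s))) r"
      unfolding convolution_def by (rule integral_cong) (auto simp: w_def T' g[symmetric])
    also have "\<dots> = T (convolution (\<lambda>s. g s (w s)) r)"
      by (rule convolution_bounded_linear[symmetric, OF T])
         (auto intro!: continuous_on_forcing intro: continuous_on_subset[OF w])
    finally have "y (r + u) = T (S r x + convolution (\<lambda>s. g s (w s)) r)"
      using mild_shift[OF y u r] by (simp add: yu T(2)[OF r] linear_add[OF bounded_linear.linear[OF T(1)]])
    then show ?thesis by (simp add: w_def T'(2))
  qed
  with w have "mild x w" by (simp add: mild_def)
  from mild_unique[OF this y t] have "T (w t) = T (y t)" by simp
  then show ?thesis by (simp add: w_def T'(3))
qed

end

section \<open>Complex scalars and the periodic solution\<close>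

lemma bounded_linear_scaleC: "bounded_linear (\<lambda>x::'a::complex_banach. c *\<^sub>C x)"
proof (rule bounded_linear_intro[of _ "cmod c"])
  show "c *\<^sub>C (r *\<^sub>R x) = r *\<^sub>R (c *\<^sub>C x)" for r and x :: 'a
    by (metis mult.commute scaleC_of_real scaleC_scaleC)
qed (auto simp: scaleC_add_right norm_scaleC mult.commute)

lemma scaleC_inverse_cancel:
  assumes "c \<noteq> 0"
  shows "inverse c *\<^sub>C c *\<^sub>C x = x" "c *\<^sub>C inverse c *\<^sub>C x = x"
  using assms scaleC_of_real[of 1 x] by (auto simp: scaleC_scaleC)

theorem theorem5p6:
  fixes S :: "real \<Rightarrow> 'a::complex_banach \<Rightarrow> 'a"
    and D :: "'a set" and A :: "'a \<Rightarrow> 'a"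
    and g :: "real \<Rightarrow> 'a \<Rightarrow> 'a"
    and c :: complex and \<omega> Q \<gamma> L g1 g2 :: real
  assumes "\<omega> > 0" and "c \<noteq> 0"
    and "C0_semigroup S"
    and "infinitesimal_generator D A S"
    and "\<forall>t>0. compact_operator (S t)"
    and "Q \<ge> 1"
    and "\<forall>t\<ge>0. onorm (S t) \<le> Q * exp (\<gamma> * t)"
    and "c \<notin> spectrum (S \<omega>)"
    and "continuous_on ({0..} \<times> UNIV) (\<lambda>(t, y). g t y)"
    and "\<forall>t\<ge>0. \<forall>y. g (t + \<omega>) (c *\<^sub>C y) = c *\<^sub>C g t y"
    and "L > 0"
    and "\<forall>t\<ge>0. \<forall>y1 y2. norm (g t y1 - g t y2) \<le> L * norm (y1 - y2)"
    and "g1 \<ge> 0" and "g2 \<ge> 0"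
    and "\<forall>t\<ge>0. \<forall>y. norm (g t y) \<le> g1 + g2 * norm y"
    and "Q * onorm (inv (\<lambda>x. c *\<^sub>C x - S \<omega> x)) * exp (\<gamma> * \<omega>) * (exp (Q * g2 * \<omega>) - 1) < 1"
  shows "\<exists>y. mild_solution S g y \<and> omega_c_periodic \<omega> c y"
proof -
  have S: "bounded_linear (S t)" "c *\<^sub>C S t x = S t (c *\<^sub>C x)" if "t \<ge> 0" for t x
    using assms(3) that by (auto simp: C0_semigroup_def bounded_clinear_def)
  interpret semilinear_equation S Q \<gamma> g L g1 g2
  proof (intro semilinear_equation.intro exp_bounded_semigroup.intro semilinear_equation_axioms.intro)
    show "norm (S t x) \<le> Q * exp (\<gamma> * t) * norm x" if "t \<ge> 0" for t x
      using onorm[OF S(1)[OF that], of x] assms(7) that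
      by (meson mult_right_mono norm_ge_zero order_trans)
    show "S 0 x = x" "((\<lambda>t. S t x) \<longlongrightarrow> x) (at_right 0)" for x
      using assms(3) by (simp_all add: C0_semigroup_def)
    show "S (s + t) x = S s (S t x)" if "s \<ge> 0" "t \<ge> 0" for s t x
      using assms(3) that by (simp add: C0_semigroup_def)
    show "bounded_linear (S t)" if "t \<ge> 0" for t
      by (rule S(1)[OF that])
  qed (use assms(6,9,11-15) in auto)
  define R where "R = inv (\<lambda>x. c *\<^sub>C x - S \<omega> x)"
  \<comment> \<open>Outside the spectrum \<open>inv\<close> is a genuine two-sided inverse and
    bounded, that is, the resolvent of \<open>S \<omega>\<close> at \<open>c\<close>.\<close>
  have bij: "bij (\<lambda>x. c *\<^sub>C x - S \<omega> x)" and R: "bounded_linear R"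
    using assms(8) by (auto simp: spectrum_def R_def bounded_clinear_def)
  obtain x y where y: "mild x y" and x: "R (convolution (\<lambda>s. g s (y s)) \<omega>) = x"
    by (rule mild_resolvent_fixed_point[of \<omega> R])
       (use assms(1,5,16) R in \<open>auto simp: compact_operator_def R_def\<close>)
  \<comment> \<open>Applying \<open>c I - S \<omega>\<close> to the fixed point equation undoes the
    resolvent; adding \<open>S \<omega> x\<close> then gives the end value
    \<open>c *\<^sub>C x\<close>.\<close>
  have "convolution (\<lambda>s. g s (y s)) \<omega> = c *\<^sub>C x - S \<omega> x"
    unfolding x[symmetric] R_def
    by (rule surj_f_inv_f[OF bij_is_surj[OF bij], symmetric])
  then have end_value: "y \<omega> = c *\<^sub>C x"
    using y assms(1) by (simp add: mild_def)
  have "y (t + \<omega>) = c *\<^sub>C y t" if "t \<ge> 0" for t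
    by (rule mild_periodic[OF y, where T = "\<lambda>x. c *\<^sub>C x" and T' = "\<lambda>x. inverse c *\<^sub>C x"])
       (use assms(1,10) end_value that S(2) scaleC_inverse_cancel[OF assms(2)] bounded_linear_scaleC in simp_all)
  moreover have "mild_solution S g y"
    unfolding mild_solution_def
  proof (intro conjI exI allI impI)
    show "continuous_on {0..} y" using y by (simp add: mild_def)
    fix t :: real assume t: "t \<ge> 0"
    show "(\<lambda>s. S (t - s) (g s (y s))) integrable_on {0..t}"
      by (rule integrable_convolution) (rule mild_forcing_continuous[OF y], auto)
    show "y t = S t x + integral {0..t} (\<lambda>s. S (t - s) (g s (y s)))"
      using y t by (simp add: mild_def convolution_def)
  qed
  ultimately show ?thesis by (auto simp: omega_c_periodic_def)
qed

end
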